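(* Let $(X,d)$ be a complete metric space, let $\mathscr{G}$ be a locally uniformly upper semicontinuous (LUUS) generalized process in $X$ composed of continuous functions and asymptotically backward autonomous for $\mathcal{A}=\{\mathcal{A}(t)\}_{t\in\mathbb{R}}$, a quasi-invariant global selected pullback attractor of $\mathscr{G}$, and let $\mathcal{A}_\infty$ be the global attractor of the corresponding autonomous problem. If $$\lim_{t\to-\infty}\mathrm{dist}(\mathcal{A}(t),\mathcal{A}_\infty)=0,$$ then the selected pullback attractor $\mathcal{A}$ is backward compact, i.e., $\overline{\bigcup_{s\le t}\mathcal{A}(s)}$ is compact for all $t\in\mathbb{R}$.
   Context: Let $(X,d)$ be a complete metric space. For nonempty $A,B\subset X$: $\mathrm{dist}(A,B)=\sup_{a\in A}\inf_{b\in B}d(a,b)$; for $\varepsilon>0$, $\mathcal{O}_\varepsilon(A)=\{z\in X:\inf_{a\in A}d(z,a)<\varepsilon\}$. Generalized process: a family $\mathscr{G}=\{\mathscr{G}(\tau)\}_{\tau\in\mathbb{R}}$ of sets $\mathscr{G}(\tau)$ consisting of functions $\varphi:[\tau,\infty)\to X$ (called solutions) such that: (C1) for each $\tau\in\mathbb{R}$ and $z\in X$ there is at least one $\varphi\in\mathscr{G}(\tau)$ with $\varphi(\tau)=z$; (C2) if $\varphi\in\mathscr{G}(\tau)$ and $s\ge 0$, then $\varphi|_{[\tau+s,\infty)}\in\mathscr{G}(\tau+s)$; (C3) if $\{\varphi_j\}_{j\in\mathbb{N}}\subset\mathscr{G}(\tau)$ and $\varphi_j(\tau)\to z$, then there are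 a subsequence $\{\varphi_{j_k}\}$ and $\varphi\in\mathscr{G}(\tau)$ with $\varphi(\tau)=z$ and $\varphi_{j_k}(t)\to\varphi(t)$ as $k\to\infty$ for each $t\ge\tau$. $\mathscr{G}$ is locally uniformly upper semicontinuous (LUUS) if: whenever $\varphi_j\in\mathscr{G}(\tau)$ for all $j\in\mathbb{N}$ and $\varphi_j(\tau)\to z$, there are $\varphi\in\mathscr{G}(\tau)$ with $\varphi(\tau)=z$ and a subsequence $\{\varphi_{j_k}\}$ with $\varphi_{j_k}\to\varphi$ uniformly on compact subsets of $[\tau,\infty)$. A complete orbit (complete trajectory) through $x\in X$ at $\tau\in\mathbb{R}$ is a map $\psi:\mathbb{R}\to X$ with $\psi(\tau)=x$ and $\psi|_{[\tau+s,\infty)}\in\mathscr{G}(\tau+s)$ for all $s\in\mathbb{R}$. A family $\mathcal{A}=\{\mathcal{A}(t)\}_{t\in\mathbb{R}}$ of subsets of $X$ is quasi-invariant if for each $\tau\in\mathbb{R}$ and $z\in\mathcal{A}(\tau)$ there is a complete orbit $\psi$ through $z$ at $\tau$ with $\psi(t)\in\mathcal{A}(t)$ for all $t\in\mathbb{R}$. $\mathcal{A}$ select pullback attracts $x\in X$ at time $t\in\mathbb{R}$ if for every $\varepsilon>0$ there is $\tau_0\le t$ such that for all $\tau\le\tau_0$ there is $\varphi_\tau\in\mathscr{G}(\tau)$ with $\varphi_\tau(\tau)=x$ and $\varphi_\tau(t)\in\mathcal{O}_\varepsilon(\mathcal{A}(t))$. A global selected pullback attractor of $\mathscr{G}$ is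 a family of nonempty compact subsets $\mathcal{A}(t)$, $t\in\mathbb{R}$, of $X$ which select pullback attracts every $x\in X$ at every time $t\in\mathbb{R}$. Autonomous problem: it is given by a set $\mathcal{S}$ of functions $\varphi:[0,\infty)\to X$ (its solutions) such that every $z\in X$ is the initial value $\varphi(0)$ of some $\varphi\in\mathcal{S}$ and $\varphi(\cdot+s)\in\mathcal{S}$ for $\varphi\in\mathcal{S}$, $s\ge0$. Its multivalued semigroup is $G(t,B)=\{\varphi(t):\varphi\in\mathcal{S},\ \varphi(0)\in B\}$, $t\ge 0$, $B\subset X$. Its global attractor $\mathcal{A}_\infty$ is a nonempty compact set with $\mathcal{A}_\infty\subset G(t,\mathcal{A}_\infty)$ for all $t\ge0$ and $\mathrm{dist}(G(t,B),\mathcal{A}_\infty)\to0$ as $t\to\infty$ for every nonempty bounded $B\subset X$. $\mathscr{G}$ is asymptotically backward autonomous for $\mathcal{A}$ (a quasi-invariant global selected pullback attractor), with corresponding autonomous problem $\mathcal{S}$, if: for every sequence of times $\tau\to-\infty$ and points $x_\tau\in\mathcal{A}(\tau)$ with $x_\tau\to x_0$ in $X$ as $\tau\to-\infty$, and all complete trajectories $\varphi_\tau$ with $\varphi_\tau(\tau)=x_\tau$ and $\varphi_\tau(s)\in\mathcal{A}(s)$ for all $s\in\mathbb{R}$, there is a solution $\varphi\in\mathcal{S}$ of the autonomous problem with $\varphi(0)=x_0$ and $\varphi_\tau(t+\tau)\to\varphi(t)$ as $\tau\to-\infty$ along the sequence, for each $t\ge0$. *)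

theory Defs
  imports "HOL-Analysis.Analysis"
begin

(* Extended-valued: the supremum may be infinite when A is unbounded. *)
definition hsemidist :: "'a::metric_space set \<Rightarrow> 'a set \<Rightarrow> ennreal" where
  "hsemidist A B = (SUP a\<in>A. INF b\<in>B. ennreal (dist a b))"

(* Meant for nonempty A only: infdist z {} = 0 by convention. *)
definition eps_nbhd :: "real \<Rightarrow> 'a::metric_space set \<Rightarrow> 'a set" where
  "eps_nbhd \<epsilon> A = {z. infdist z A < \<epsilon>}"

(* A function [\<tau>,\<infinity>) \<rightarrow> X is encoded as a total function that is extensional on {\<tau>..}, i.e. equal
   to undefined outside {\<tau>..}; thus equality in G \<tau> is equality of functions on [\<tau>,\<infinity>), and the
   restriction of a solution is again encoded canonically by restrict. *)
definition generalized_process :: "(real \<Rightarrow> (real \<Rightarrow> 'a::metric_space) set) \<Rightarrow> bool" where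
  "generalized_process G \<longleftrightarrow>
     (\<forall>\<tau>. G \<tau> \<subseteq> extensional {\<tau>..}) \<and>
     (\<forall>\<tau> z. \<exists>\<phi>\<in>G \<tau>. \<phi> \<tau> = z) \<and>
     (\<forall>\<tau>. \<forall>\<phi>\<in>G \<tau>. \<forall>s\<ge>0. restrict \<phi> {\<tau> + s..} \<in> G (\<tau> + s)) \<and>
     (\<forall>\<tau> (\<phi>s :: nat \<Rightarrow> real \<Rightarrow> 'a) z.
        (\<forall>j. \<phi>s j \<in> G \<tau>) \<longrightarrow> (\<lambda>j. \<phi>s j \<tau>) \<longlonglongrightarrow> z \<longrightarrow>
        (\<exists>r :: nat \<Rightarrow> nat. strict_mono r \<and>
          (\<exists>\<phi>\<in>G \<tau>. \<phi> \<tau> = z \<and> (\<forall>t\<ge>\<tau>. (\<lambda>k. \<phi>s (r k) t) \<longlonglongrightarrow> \<phi> t))))"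

definition LUUS :: "(real \<Rightarrow> (real \<Rightarrow> 'a::metric_space) set) \<Rightarrow> bool" where
  "LUUS G \<longleftrightarrow>
     (\<forall>\<tau> (\<phi>s :: nat \<Rightarrow> real \<Rightarrow> 'a) z.
        (\<forall>j. \<phi>s j \<in> G \<tau>) \<longrightarrow> (\<lambda>j. \<phi>s j \<tau>) \<longlonglongrightarrow> z \<longrightarrow>
        (\<exists>\<phi>\<in>G \<tau>. \<phi> \<tau> = z \<and>
          (\<exists>r :: nat \<Rightarrow> nat. strict_mono r \<and>
            (\<forall>K. compact K \<longrightarrow> K \<subseteq> {\<tau>..} \<longrightarrow>
              uniform_limit K (\<lambda>k. \<phi>s (r k)) \<phi> sequentially))))"

definition composed_of_continuous ::
    "(real \<Rightarrow> (real \<Rightarrow> 'a::metric_space) set) \<Rightarrow> bool" where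
  "composed_of_continuous G \<longleftrightarrow> (\<forall>\<tau>. \<forall>\<phi>\<in>G \<tau>. continuous_on {\<tau>..} \<phi>)"

definition complete_orbit ::
    "(real \<Rightarrow> (real \<Rightarrow> 'a::metric_space) set) \<Rightarrow> real \<Rightarrow> 'a \<Rightarrow> (real \<Rightarrow> 'a) \<Rightarrow> bool" where
  "complete_orbit G \<tau> x \<psi> \<longleftrightarrow>
     \<psi> \<tau> = x \<and> (\<forall>s. restrict \<psi> {\<tau> + s..} \<in> G (\<tau> + s))"

definition quasi_invariant ::
    "(real \<Rightarrow> (real \<Rightarrow> 'a::metric_space) set) \<Rightarrow> (real \<Rightarrow> 'a set) \<Rightarrow> bool" where
  "quasi_invariant G A \<longleftrightarrow>
     (\<forall>\<tau>. \<forall>z\<in>A \<tau>. \<exists>\<psi>. complete_orbit G \<tau> z \<psi> \<and> (\<forall>t. \<psi> t \<in> A t))"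

definition select_pullback_attracts ::
    "(real \<Rightarrow> (real \<Rightarrow> 'a::metric_space) set) \<Rightarrow> (real \<Rightarrow> 'a set) \<Rightarrow> 'a \<Rightarrow> real \<Rightarrow> bool" where
  "select_pullback_attracts G A x t \<longleftrightarrow>
     (\<forall>\<epsilon>>0. \<exists>\<tau>0\<le>t. \<forall>\<tau>\<le>\<tau>0. \<exists>\<phi>\<in>G \<tau>. \<phi> \<tau> = x \<and> \<phi> t \<in> eps_nbhd \<epsilon> (A t))"

definition global_selected_pullback_attractor ::
    "(real \<Rightarrow> (real \<Rightarrow> 'a::metric_space) set) \<Rightarrow> (real \<Rightarrow> 'a set) \<Rightarrow> bool" where
  "global_selected_pullback_attractor G A \<longleftrightarrow>
     (\<forall>t. A t \<noteq> {} \<and> compact (A t)) \<and>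
     (\<forall>x t. select_pullback_attracts G A x t)"

(* Solutions on [0,\<infinity>) are encoded as for generalized processes. *)
definition autonomous_problem :: "(real \<Rightarrow> 'a::metric_space) set \<Rightarrow> bool" where
  "autonomous_problem S \<longleftrightarrow>
     S \<subseteq> extensional {0..} \<and>
     (\<forall>z. \<exists>\<phi>\<in>S. \<phi> 0 = z) \<and>
     (\<forall>\<phi>\<in>S. \<forall>s\<ge>0. restrict (\<lambda>t. \<phi> (t + s)) {0..} \<in> S)"

definition multi_semigroup ::
    "(real \<Rightarrow> 'a::metric_space) set \<Rightarrow> real \<Rightarrow> 'a set \<Rightarrow> 'a set" where
  "multi_semigroup S t B = {\<phi> t | \<phi>. \<phi> \<in> S \<and> \<phi> 0 \<in> B}"

definition global_attractor :: "(real \<Rightarrow> 'a::metric_space) set \<Rightarrow> 'a set \<Rightarrow> bool" where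
  "global_attractor S A \<longleftrightarrow>
     A \<noteq> {} \<and> compact A \<and>
     (\<forall>t\<ge>0. A \<subseteq> multi_semigroup S t A) \<and>
     (\<forall>B. B \<noteq> {} \<longrightarrow> bounded B \<longrightarrow>
        ((\<lambda>t. hsemidist (multi_semigroup S t B) A) \<longlongrightarrow> 0) at_top)"

definition asymptotically_backward_autonomous ::
    "(real \<Rightarrow> (real \<Rightarrow> 'a::metric_space) set) \<Rightarrow> (real \<Rightarrow> 'a set) \<Rightarrow>
     (real \<Rightarrow> 'a) set \<Rightarrow> bool" where
  "asymptotically_backward_autonomous G A S \<longleftrightarrow>
     (\<forall>(\<tau> :: nat \<Rightarrow> real) x x\<^sub>0 (\<phi>s :: nat \<Rightarrow> real \<Rightarrow> 'a).
        filterlim \<tau> at_bot sequentially \<longrightarrow>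
        (\<forall>n. x n \<in> A (\<tau> n)) \<longrightarrow> x \<longlonglongrightarrow> x\<^sub>0 \<longrightarrow>
        (\<forall>n. complete_orbit G (\<tau> n) (x n) (\<phi>s n) \<and> (\<forall>s. \<phi>s n s \<in> A s)) \<longrightarrow>
        (\<exists>\<phi>\<in>S. \<phi> 0 = x\<^sub>0 \<and> (\<forall>t\<ge>0. (\<lambda>n. \<phi>s n (t + \<tau> n)) \<longlonglongrightarrow> \<phi> t)))"

definition backward_compact :: "(real \<Rightarrow> 'a::metric_space set) \<Rightarrow> bool" where
  "backward_compact A \<longleftrightarrow> (\<forall>t. compact (closure (\<Union>s\<in>{..t}. A s)))"

end

theory Submission
  imports Defs
begin

text \<open>Relative compactness is checked on sequences $y_n \in \mathcal{A}(s_n)$ with $s_n \le t$.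
  If $s_n \to -\infty$, the points approach the compact set $\mathcal{A}_\infty$. Otherwise infinitely
  many $s_n$ lie in some $[a,t]$; quasi-invariance joins $y_n$ to a point of the compact set
  $\mathcal{A}(a)$ by a solution, and LUUS gives a subsequence of these solutions converging uniformly
  on $[a,t]$ to a continuous one, so that evaluation at the convergent times $s_n$ converges too.\<close>

lemma tendsto_of_dist_tendsto_0:
  fixes f g :: "'b \<Rightarrow> 'a::metric_space"
  assumes "(f \<longlongrightarrow> l) F" "((\<lambda>x. dist (f x) (g x)) \<longlongrightarrow> 0) F"
  shows "(g \<longlongrightarrow> l) F"
proof -
  have "((\<lambda>x. dist (f x) (g x) + dist (f x) l) \<longlongrightarrow> 0) F"
    using tendsto_add[OF assms(2) assms(1)[THEN tendsto_dist_iff[THEN iffD1]]] by simp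
  then have "((\<lambda>x. dist (g x) l) \<longlongrightarrow> 0) F"
    by (rule tendsto_sandwich[OF _ _ tendsto_const, rotated 2])
       (simp_all add: dist_triangle3)
  then show ?thesis
    by (rule tendsto_dist_iff[THEN iffD2])
qed

text \<open>A sequence in the closure is shadowed by one in \<open>U\<close> at distance below
  \<open>1/(n+1)\<close>, so both converge along the same subsequence. The limit may be sought
  anywhere in the space, since a closed set retains the limits of its sequences.\<close>

lemma compact_closure_if_convergent_subseqs:
  fixes U :: "'a::metric_space set"
  assumes "\<And>y :: nat \<Rightarrow> 'a. (\<And>n. y n \<in> U) \<Longrightarrow> \<exists>r l. strict_mono r \<and> (\<lambda>n. y (r n)) \<longlonglongrightarrow> l"
  shows "compact (closure U)"
proof -
  have "\<exists>l\<in>closure U. \<exists>r. strict_mono r \<and> (x \<circ> r) \<longlonglongrightarrow> l"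
    if x: "\<And>n. x n \<in> closure U" for x :: "nat \<Rightarrow> 'a"
  proof -
    have "\<exists>y\<in>U. dist y (x n) < inverse (real (Suc n))" for n
      using x[of n] by (simp add: closure_approachable)
    then obtain y where y: "\<And>n. y n \<in> U" "\<And>n. dist (y n) (x n) < inverse (real (Suc n))"
      by metis
    obtain r l where r: "strict_mono r" and l: "(\<lambda>n. y (r n)) \<longlonglongrightarrow> l"
      using assms[of y] y(1) by blast
    have "(\<lambda>n. dist (y n) (x n)) \<longlonglongrightarrow> 0"
      by (rule tendsto_sandwich[OF _ _ tendsto_const LIMSEQ_inverse_real_of_nat])
         (use y(2) in \<open>auto intro!: always_eventually less_imp_le simp del: of_nat_Suc\<close>)
    then have "(\<lambda>n. dist (y (r n)) (x (r n))) \<longlonglongrightarrow> 0"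
      using LIMSEQ_subseq_LIMSEQ[OF _ r] by (simp add: o_def)
    then have "(x \<circ> r) \<longlonglongrightarrow> l"
      using tendsto_of_dist_tendsto_0[OF l] by (simp add: o_def)
    moreover from this have "l \<in> closure U"
      using x by (intro Lim_in_closed_set[of "closure U" "x \<circ> r"]) auto
    ultimately show ?thesis
      using r by blast
  qed
  then show ?thesis
    unfolding compact_eq_seq_compact_metric seq_compact_def by blast
qed

text \<open>Compare with \<open>g (x n)\<close>: uniformity bounds
  \<open>dist (g (x n)) (f n (x n))\<close> at the moving point \<open>x n\<close>, where pointwise
  convergence would say nothing, and continuity of \<open>g\<close> on \<open>K\<close> gives the
  limit of \<open>g (x n)\<close>.\<close>

lemma uniform_limit_tendsto_at:
  fixes f :: "nat \<Rightarrow> 'a::topological_space \<Rightarrow> 'b::metric_space"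
  assumes f: "uniform_limit K f g sequentially" and g: "continuous_on K g"
    and x: "x \<longlonglongrightarrow> l" "\<And>n. x n \<in> K" and l: "l \<in> K"
  shows "(\<lambda>n. f n (x n)) \<longlonglongrightarrow> g l"
proof (rule tendsto_of_dist_tendsto_0)
  show "(\<lambda>n. g (x n)) \<longlonglongrightarrow> g l"
    using continuous_on_tendsto_compose[OF g x(1) l] x(2) by simp
  show "(\<lambda>n. dist (g (x n)) (f n (x n))) \<longlonglongrightarrow> 0"
    unfolding tendsto_iff
  proof safe
    fix e :: real assume "e > 0"
    from uniform_limitD[OF f this] show "\<forall>\<^sub>F n in sequentially. dist (dist (g (x n)) (f n (x n))) 0 < e"
      by eventually_elim (use x(2) in \<open>auto simp: dist_commute\<close>)
  qed
qed

text \<open>Passes from the extended-valued semidistance of sets to the real distance of single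
  points. For empty \<open>B\<close> the left side is 0 by convention.\<close>

lemma infdist_le_hsemidist:
  assumes "y \<in> A"
  shows "ennreal (infdist y B) \<le> hsemidist A B"
proof -
  have "ennreal (infdist y B) \<le> (INF b\<in>B. ennreal (dist y b))"
    by (intro INF_greatest ennreal_leI infdist_le)
  also have "\<dots> \<le> hsemidist A B"
    unfolding hsemidist_def using assms by (rule SUP_upper)
  finally show ?thesis .
qed

text \<open>Each \<open>y n\<close> has a nearest point in the compact set \<open>B\<close>. These
  nearest points have a convergent subsequence, and \<open>y\<close> follows it because the gap is
  exactly \<open>infdist (y n) B\<close>.\<close>

lemma convergent_subseq_of_infdist_tendsto_0:
  fixes y :: "nat \<Rightarrow> 'a::metric_space"
  assumes B: "compact B" "B \<noteq> {}" and y: "(\<lambda>n. infdist (y n) B) \<longlonglongrightarrow> 0"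
  shows "\<exists>r l. strict_mono r \<and> (\<lambda>n. y (r n)) \<longlonglongrightarrow> l"
proof -
  have "\<exists>b\<in>B. infdist (y n) B = dist (y n) b" for n
  proof -
    have "continuous_on B (dist (y n))"
      by (intro continuous_on_dist continuous_on_const continuous_on_id)
    from continuous_attains_inf[OF B this]
    obtain b where b: "b \<in> B" "\<And>c. c \<in> B \<Longrightarrow> dist (y n) b \<le> dist (y n) c"
      by blast
    \<comment> \<open>As \<open>B\<close> is nonempty, \<open>infdist\<close> is a true infimum here
      and not the default 0, so the minimum at \<open>b\<close> is a lower bound for it.\<close>
    then have "dist (y n) b \<le> infdist (y n) B"
      unfolding infdist_notempty[OF B(2)] by (intro cINF_greatest B(2))
    with b(1) show ?thesis
      by (auto intro!: bexI[of _ b] antisym infdist_le)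
  qed
  then obtain b where b: "\<And>n. b n \<in> B" "\<And>n. infdist (y n) B = dist (y n) (b n)"
    by metis
  obtain l r where r: "strict_mono r" and l: "(b \<circ> r) \<longlonglongrightarrow> l"
    using B(1) b(1) unfolding compact_eq_seq_compact_metric seq_compact_def by blast
  have "(\<lambda>n. dist (b (r n)) (y (r n))) \<longlonglongrightarrow> 0"
    using LIMSEQ_subseq_LIMSEQ[OF y r] by (simp add: o_def b(2) dist_commute)
  then have "(\<lambda>n. y (r n)) \<longlonglongrightarrow> l"
    using l by (auto simp: o_def intro: tendsto_of_dist_tendsto_0)
  with r show ?thesis by blast
qed

text \<open>Following all orbits from the common time \<open>a\<close> places them in the single set
  \<open>G a\<close> with initial values in the compact set \<open>A a\<close>, as LUUS requires.
  The points \<open>y n\<close> are then recovered by evaluating at the varying times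
  \<open>s n\<close>.\<close>

lemma convergent_subseq_bounded_times:
  fixes A :: "real \<Rightarrow> 'a::metric_space set"
  assumes luus: "LUUS G" and cont: "composed_of_continuous G" and inv: "quasi_invariant G A"
    and cpt: "compact (A a)" and s: "\<And>n. s n \<in> {a..t}" and y: "\<And>n. y n \<in> A (s n)"
  shows "\<exists>r l. strict_mono (r :: nat \<Rightarrow> nat) \<and> (\<lambda>n. y (r n)) \<longlonglongrightarrow> l"
proof -
  have "\<exists>\<psi>. complete_orbit G (s n) (y n) \<psi> \<and> (\<forall>t. \<psi> t \<in> A t)" for n
    using inv y unfolding quasi_invariant_def by blast
  then obtain \<psi> where \<psi>: "\<And>n. complete_orbit G (s n) (y n) (\<psi> n)" "\<And>n t. \<psi> n t \<in> A t"
    by metis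
  define \<phi>s where "\<phi>s n = restrict (\<psi> n) {a..}" for n
  \<comment> \<open>Take the offset \<open>a - s n\<close> in \<open>complete_orbit\<close>: it is
    at most 0, and complete orbits may be restricted from times before their base point as
    well.\<close>
  have \<phi>s: "\<phi>s n \<in> G a" for n
    using \<psi>(1)[of n] unfolding complete_orbit_def \<phi>s_def
    by (metis add.commute diff_add_cancel)
  have \<phi>s_s: "\<phi>s n (s n) = y n" for n
    using \<psi>(1)[of n] s[of n] unfolding complete_orbit_def \<phi>s_def by simp
  have "\<forall>n. \<phi>s n a \<in> A a"
    using \<psi>(2) by (simp add: \<phi>s_def)
  then obtain z r1 where r1: "strict_mono r1" and z: "(\<lambda>n. \<phi>s (r1 n) a) \<longlonglongrightarrow> z"
    using seq_compactE[OF compact_imp_seq_compact[OF cpt], of "\<lambda>n. \<phi>s n a"]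
    unfolding o_def by blast
  obtain \<phi> r2 where \<phi>: "\<phi> \<in> G a" and r2: "strict_mono r2"
    and unif: "\<And>K. compact K \<Longrightarrow> K \<subseteq> {a..} \<Longrightarrow>
      uniform_limit K (\<lambda>k. \<phi>s (r1 (r2 k))) \<phi> sequentially"
    using luus[unfolded LUUS_def, rule_format, of "\<lambda>n. \<phi>s (r1 n)" a z] \<phi>s z by blast
  have "\<forall>n. s (r1 (r2 n)) \<in> {a..t}"
    using s by blast
  then obtain l r3 where l: "l \<in> {a..t}" and r3: "strict_mono r3"
    and lim: "(\<lambda>n. s (r1 (r2 (r3 n)))) \<longlonglongrightarrow> l"
    using seq_compactE[OF compact_imp_seq_compact[OF compact_Icc[of a t]],
        of "\<lambda>n. s (r1 (r2 n))"]
    unfolding o_def by blast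
  \<comment> \<open>Uniform convergence survives thinning by \<open>r3\<close>, so initial values,
    solutions and times all converge along one common subsequence.\<close>
  have "uniform_limit {a..t} (\<lambda>k. \<phi>s (r1 (r2 (r3 k)))) \<phi> sequentially"
    using filterlim_compose[OF unif filterlim_subseq[OF r3], of "{a..t}"] by simp
  moreover have "continuous_on {a..t} \<phi>"
    using cont \<phi> unfolding composed_of_continuous_def by (auto intro: continuous_on_subset[where s = "{a..}"])
  ultimately have "(\<lambda>n. \<phi>s (r1 (r2 (r3 n))) (s (r1 (r2 (r3 n))))) \<longlonglongrightarrow> \<phi> l"
    by (rule uniform_limit_tendsto_at[OF _ _ lim s l])
  then have "(\<lambda>n. y (r1 (r2 (r3 n)))) \<longlonglongrightarrow> \<phi> l"
    by (simp add: \<phi>s_s)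
  moreover have "strict_mono (\<lambda>n. r1 (r2 (r3 n)))"
    using r1 r2 r3 by (simp add: strict_mono_def)
  ultimately show ?thesis by blast
qed

theorem theorem19:
  fixes G :: "real \<Rightarrow> (real \<Rightarrow> 'a::complete_space) set"
    and A :: "real \<Rightarrow> 'a set"
    and S :: "(real \<Rightarrow> 'a) set"
    and A_inf :: "'a set"
  assumes "generalized_process G"
    and "LUUS G"
    and "composed_of_continuous G"
    and "quasi_invariant G A"
    and "global_selected_pullback_attractor G A"
    and "autonomous_problem S"
    and "asymptotically_backward_autonomous G A S"
    and "global_attractor S A_inf"
    and "((\<lambda>t. hsemidist (A t) A_inf) \<longlongrightarrow> 0) at_bot"
  shows "backward_compact A"
  unfolding backward_compact_def
proof (intro allI compact_closure_if_convergent_subseqs)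
  fix t :: real and y :: "nat \<Rightarrow> 'a"
  assume "\<And>n. y n \<in> (\<Union>s\<in>{..t}. A s)"
  then have "\<forall>n. \<exists>s\<le>t. y n \<in> A s"
    by auto
  then obtain s where s: "\<And>n. s n \<le> t" and y: "\<And>n. y n \<in> A (s n)"
    by metis
  have A_inf: "compact A_inf" "A_inf \<noteq> {}"
    using assms(8) by (auto simp: global_attractor_def)
  show "\<exists>r l. strict_mono r \<and> (\<lambda>n. y (r n)) \<longlonglongrightarrow> l"
  proof (cases "filterlim s at_bot sequentially")
    case True
    \<comment> \<open>Squeezed between 0 and \<open>hsemidist (A (s n)) A_inf\<close>, which
      vanishes in the limit because \<open>s n\<close> tends to minus infinity.\<close>
    have "(\<lambda>n. ennreal (infdist (y n) A_inf)) \<longlonglongrightarrow> 0"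
      by (rule tendsto_sandwich[OF _ _ tendsto_const filterlim_compose[OF assms(9) True]])
         (use infdist_le_hsemidist[OF y] A_inf in \<open>auto intro!: always_eventually\<close>)
    then have "(\<lambda>n. infdist (y n) A_inf) \<longlonglongrightarrow> 0"
      by (simp add: ennreal_tendsto_0_iff infdist_nonneg)
    with A_inf show ?thesis
      by (intro convergent_subseq_of_infdist_tendsto_0)
  next
    case False
    \<comment> \<open>Failure of divergence to minus infinity yields a level \<open>a\<close>
      exceeded by infinitely many \<open>s n\<close>. Enumerating these indices gives a subsequence
      with all its times in \<open>{a..t}\<close>.\<close>
    then obtain a where "\<not> (\<forall>\<^sub>F n in sequentially. s n \<le> a)"
      unfolding filterlim_at_bot by blast
    then have "infinite {n. a < s n}"
      by (simp add: INFM_iff_infinite[symmetric] cofinite_eq_sequentially frequently_def not_less)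
    then obtain r :: "nat \<Rightarrow> nat" where r: "strict_mono r" "\<And>n. a < s (r n)"
      using infinite_enumerate[of "{n. a < s n}"] by blast
    have "compact (A a)"
      using assms(5) by (simp add: global_selected_pullback_attractor_def)
    then obtain r' l where "strict_mono r'" "(\<lambda>n. y (r (r' n))) \<longlonglongrightarrow> l"
      using convergent_subseq_bounded_times[OF assms(2,3,4), of a "\<lambda>n. s (r n)" t "\<lambda>n. y (r n)"]
        r(2) s y by (auto simp: less_imp_le)
    with r(1) show ?thesis
      using strict_mono_o[of r r'] by (intro exI[of _ "r \<circ> r'"]) auto
  qed
qed

end
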